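(* Let $\mu$ be a Borel probability measure on $\mathbb{C}$ with compact support $S$ for which there are constants $C<\infty$ and $\epsilon>0$ such that $\mu(B(z,r))\le Cr^{\epsilon}$ for all $z\in\mathbb{C}$ and all $r>0$. Let $U_\mu(z)=\int_S\log|z-w|\,d\mu(w)$, and let $L$ be a compact subset of $\{z\in\mathbb{C}:U_\mu(z)\ge m\}$ for some $m>0$. Let $X_1,X_2,\dots$ be i.i.d. random variables with distribution $\mu$, let $p_n(z)=\prod_{k=1}^n(z-X_k)$ and $\Lambda_n=\{z\in\mathbb{C}:|p_n(z)|<1\}$. Then there exists $c_0>0$ such that $$\Lambda_n\cap L\subset\bigcup_{k=1}^nB(X_k,e^{-c_0n})\quad\text{with overwhelming probability.}$$
   Context: $B(z,r)$ denotes the disk of center $z$ and radius $r$ in $\mathbb{C}$. A sequence of events $E_n$ holds with overwhelming probability if there is a constant $c>0$ (independent of $n$) such that $\mathbb{P}(E_n)\ge 1-e^{-cn}$ for all sufficiently large $n$. *)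

theory Defs
  imports "HOL-Probability.Probability"
begin

definition msupport :: "'a::topological_space measure \<Rightarrow> 'a set" where
  "msupport \<mu> = {z. \<forall>U. open U \<and> z \<in> U \<longrightarrow> emeasure \<mu> U > 0}"

text \<open>
  With the conventions of the library \<open>ln 0 = 0\<close>, and the integral of a non-integrable
  function is \<open>0\<close>. Neither matters for a compactly supported finite measure with
  \<open>\<mu>(B(z,r)) \<le> C r\<^sup>\<epsilon>\<close> (\<open>\<epsilon> > 0\<close>): it has no atoms, and the logarithm is integrable.
\<close>

definition log_potential :: "complex measure \<Rightarrow> complex \<Rightarrow> real" where
  "log_potential \<mu> z = (LINT w:msupport \<mu>|\<mu>. ln (cmod (z - w)))"

text \<open>
  The sequence \<open>x\<close> of roots is indexed from \<open>1\<close>; the value \<open>x 0\<close> is not used.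
\<close>

definition root_poly :: "(nat \<Rightarrow> complex) \<Rightarrow> nat \<Rightarrow> complex \<Rightarrow> complex" where
  "root_poly x n z = (\<Prod>k=1..n. z - x k)"

definition lemniscate :: "(nat \<Rightarrow> complex) \<Rightarrow> nat \<Rightarrow> complex set" where
  "lemniscate x n = {z. cmod (root_poly x n z) < 1}"

text \<open>
  That each \<open>E n\<close> is an event, i.e. measurable, is part of the notion.
\<close>

definition overwhelming_prob :: "'a measure \<Rightarrow> (nat \<Rightarrow> 'a set) \<Rightarrow> bool" where
  "overwhelming_prob M E \<longleftrightarrow>
     (\<forall>n. E n \<in> sets M) \<and>
     (\<exists>c>0. \<forall>\<^sub>F n in sequentially. measure M (E n) \<ge> 1 - exp (- c * real n))"

end

theory Submission
  imports Defs
begin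

text \<open>
  Each \<open>log|z - X\<^sub>k|\<close> has exponential moments bounded uniformly in \<open>z \<in> L\<close>, since the
  condition \<open>\<mu>(B(z,r)) \<le> C r\<^sup>\<epsilon>\<close> makes \<open>\<integral>|z - w|\<^sup>-\<^sup>a d\<mu>(w)\<close> finite for \<open>a < \<epsilon>\<close>. As its mean is at
  least \<open>m\<close>, Chernoff's inequality gives \<open>P(log|p\<^sub>n(z)| \<le> nm/2) \<le> e\<^sup>-\<^sup>\<gamma>\<^sup>n\<close> with one \<open>\<gamma>\<close> for all
  \<open>z \<in> L\<close>. If \<open>z \<in> L\<close> has \<open>|p\<^sub>n(z)| < 1\<close> and keeps distance \<open>\<rho> = e\<^sup>-\<^sup>\<gamma>\<^sup>n\<^sup>/\<^sup>4\<close> from all roots, then moving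
  it by at most \<open>s\<rho>\<close> changes each factor at most by a factor \<open>1 + s\<close>, so \<open>log|p\<^sub>n| \<le> ns \<le> nm/2\<close> at a
  nearby point of an \<open>s\<rho>\<close>-net of \<open>L\<close>. The net has only \<open>O(e\<^sup>\<gamma>\<^sup>n\<^sup>/\<^sup>2)\<close> points, so a union bound
  concludes.
\<close>

section \<open>Supports and negative moments of the distance\<close>

text \<open>The complement of the support is the union of all open null sets. By the Lindelof
  property countably many of them cover it, so it is itself null.\<close>

lemma AE_msupport:
  fixes \<mu> :: "'a::second_countable_topology measure"
  assumes "sets \<mu> = sets borel"
  shows "AE w in \<mu>. w \<in> msupport \<mu>"
proof -
  define F where "F = {U. open U \<and> emeasure \<mu> U = 0}"
  obtain F' where F': "F' \<subseteq> F" "countable F'" "\<Union>F' = \<Union>F"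
    using Lindelof_openin[of F UNIV] by (auto simp: F_def)
  have "(\<Union>U\<in>F'. U) \<in> null_sets \<mu>"
    using F' assms by (intro null_sets_UN') (auto simp: F_def null_sets_def)
  moreover have "{w \<in> space \<mu>. w \<notin> msupport \<mu>} \<subseteq> \<Union>F'"
    unfolding F'(3) by (auto simp: msupport_def F_def)
  ultimately show ?thesis by (intro AE_I') auto
qed

text \<open>Dyadic layers: where the distance is about 2^(-k), the integrand is at most
  \<open>2 powr (a * (k + 1))\<close>, and the ball condition bounds the mass by
  \<open>C * 2 powr (- k * \<epsilon>)\<close>. The products form a geometric series of ratio
  \<open>2 powr (a - \<epsilon>)\<close>, which is below 1 because a < \<epsilon>; the summand 1
  accounts for distances of at least 1.\<close>

lemma nn_integral_dist_powr_le:
  fixes \<mu> :: "'a::metric_space measure"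
  assumes \<mu>: "prob_space \<mu>" and [measurable_cong]: "sets \<mu> = sets borel"
    and ball: "\<And>r. r > 0 \<Longrightarrow> measure \<mu> (ball z r) \<le> C * r powr \<epsilon>"
    and a: "0 < a" "a < \<epsilon>"
  shows "(\<integral>\<^sup>+w. ennreal (dist z w powr - a) \<partial>\<mu>)
           \<le> ennreal (1 + 2 powr a * C / (1 - 2 powr (a - \<epsilon>)))"
proof -
  interpret prob_space \<mu> by fact
  have C: "C \<ge> 0" using order_trans[OF measure_nonneg ball[of 1]] by simp
  define q where "q = (2::real) powr (a - \<epsilon>)"
  have q: "0 < q" "q < 1" using a by (auto simp: q_def powr_less_one)
  let ?g = "\<lambda>k::nat. ennreal (2 powr (a * (real k + 1)))"
  let ?B = "\<lambda>k::nat. ball z (2 powr - real k)"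
  \<comment> \<open>For \<open>0 < |z - w| < 1\<close> the term with \<open>2\<^sup>-\<^sup>k\<^sup>-\<^sup>1 \<le> |z - w| < 2\<^sup>-\<^sup>k\<close> alone dominates.
    At \<open>w = z\<close> the left-hand side is \<open>0\<close>, by \<open>0 powr x = 0\<close>.\<close>
  have pw: "ennreal (dist z w powr - a) \<le> 1 + (\<Sum>k. ?g k * indicator (?B k) w)" for w
  proof (cases "dist z w = 0 \<or> dist z w \<ge> 1")
    case True
    then have "dist z w powr - a \<le> 1"
      using a by (auto simp: powr_minus_divide divide_le_eq ge_one_powr_ge_zero)
    then have "ennreal (dist z w powr - a) \<le> 1" by simp
    then show ?thesis by (rule order_trans) simp
  next
    case False
    define u where "u = dist z w"
    have u: "0 < u" "u < 1" using False by (auto simp: u_def)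
    \<comment> \<open>Ceiling minus one rather than floor: for u = 2^(-j) the open ball of radius
      2^(-j) misses w, so the index must be j - 1.\<close>
    define k where "k = nat (\<lceil>- log 2 u\<rceil> - 1)"
    have "- log 2 u > 0" using u by simp
    then have "\<lceil>- log 2 u\<rceil> \<ge> 1" by linarith
    then have k: "real k < - log 2 u" "- log 2 u \<le> real k + 1"
      unfolding k_def by linarith+
    have "u = 2 powr (log 2 u)" using u by simp
    also have "\<dots> < 2 powr - real k" using k by (intro powr_less_mono) auto
    finally have w: "w \<in> ?B k" by (simp add: u_def)
    have "u powr - a = 2 powr (a * (- log 2 u))" using u by (simp add: powr_def log_def)
    also have "\<dots> \<le> 2 powr (a * (real k + 1))" using k a by (intro powr_mono mult_left_mono) auto
    finally have "ennreal (dist z w powr - a) \<le> ?g k * indicator (?B k) w"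
      using w by (simp add: u_def)
    also have "\<dots> \<le> (\<Sum>k. ?g k * indicator (?B k) w)"
      by (rule order_trans[OF _ sum_le_suminf[OF summableI, of "{k}"]])
         (simp_all only: finite.intros sum.insert sum.empty empty_iff not_False_eq_True
           add_0_right order_refl zero_le)
    also have "\<dots> \<le> 1 + (\<Sum>k. ?g k * indicator (?B k) w)" by simp
    finally show ?thesis .
  qed
  have "(\<integral>\<^sup>+w. ennreal (dist z w powr - a) \<partial>\<mu>)
      \<le> (\<integral>\<^sup>+w. 1 + (\<Sum>k. ?g k * indicator (?B k) w) \<partial>\<mu>)"
    by (intro nn_integral_mono pw)
  also have "\<dots> = 1 + (\<Sum>k. ?g k * emeasure \<mu> (?B k))"
  proof -
    have meas: "(\<lambda>w. ?g k * indicator (?B k) w) \<in> borel_measurable \<mu>" for k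
      by (intro borel_measurable_times_ennreal borel_measurable_const borel_measurable_indicator)
         (simp add: assms(2))
    have "(\<integral>\<^sup>+w. 1 + (\<Sum>k. ?g k * indicator (?B k) w) \<partial>\<mu>)
        = (\<integral>\<^sup>+w. 1 \<partial>\<mu>) + (\<integral>\<^sup>+w. (\<Sum>k. ?g k * indicator (?B k) w) \<partial>\<mu>)"
      by (intro nn_integral_add borel_measurable_const borel_measurable_suminf_order meas)
    also have "(\<integral>\<^sup>+w. (\<Sum>k. ?g k * indicator (?B k) w) \<partial>\<mu>)
        = (\<Sum>k. (\<integral>\<^sup>+w. ?g k * indicator (?B k) w \<partial>\<mu>))"
      by (rule nn_integral_suminf[OF meas])
    also have "\<dots> = (\<Sum>k. ?g k * emeasure \<mu> (?B k))"
      by (intro suminf_cong nn_integral_cmult_indicator) (simp add: assms(2))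
    finally show ?thesis by (simp add: emeasure_space_1 del: suminf_ennreal)
  qed
  also have "\<dots> \<le> 1 + (\<Sum>k. ennreal (2 powr a * C * q ^ k))"
  proof (intro add_left_mono suminf_le summableI)
    fix k
    have "?g k * emeasure \<mu> (?B k) = ennreal (2 powr (a * (real k + 1)) * measure \<mu> (?B k))"
      by (simp add: emeasure_eq_measure ennreal_mult)
    also have "2 powr (a * (real k + 1)) * measure \<mu> (?B k)
        \<le> 2 powr (a * (real k + 1)) * (C * (2 powr - real k) powr \<epsilon>)"
      by (intro mult_left_mono ball) auto
    also have "\<dots> = 2 powr a * C * q ^ k"
    proof -
      have "q ^ k = 2 powr ((a - \<epsilon>) * real k)"
        using q unfolding q_def by (simp add: powr_realpow[symmetric] powr_powr)
      then show ?thesis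
        by (simp add: powr_powr powr_add[symmetric] algebra_simps)
    qed
    finally show "?g k * emeasure \<mu> (?B k) \<le> ennreal (2 powr a * C * q ^ k)"
      by (simp add: ennreal_leI)
  qed
  also have "(\<Sum>k. ennreal (2 powr a * C * q ^ k)) = ennreal (2 powr a * C * (1 / (1 - q)))"
    using q C by (intro suminf_ennreal_eq sums_mult geometric_sums) auto
  also have "1 + \<dots> = ennreal (1 + 2 powr a * C / (1 - q))"
    using q C by (simp flip: ennreal_1 ennreal_plus)
  finally show ?thesis unfolding q_def .
qed

section \<open>Moment generating functions and Chernoff's inequality\<close>

text \<open>Second-order Taylor expansion with Lagrange remainder. The exponent a|y| is split into
  two halves b|y|: one dominates the factor \<open>exp s\<close> of the remainder, since t \<le> b,
  and the other absorbs y^2.\<close>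

lemma exp_minus_le_quadratic:
  fixes y :: real
  assumes "0 < t" "2 * t \<le> a"
  shows "exp (- t * y) \<le> 1 - t * y + (2 * t / a)\<^sup>2 * exp (a * \<bar>y\<bar>)"
proof -
  define b where "b = a / 2"
  have b: "0 < b" "t \<le> b" using assms by (auto simp: b_def)
  obtain s where s: "\<bar>s\<bar> \<le> \<bar>- t * y\<bar>"
      "exp (- t * y) = (\<Sum>m<2. (- t * y) ^ m / fact m) + exp s / fact 2 * (- t * y)\<^sup>2"
    using Maclaurin_exp_le[of "- t * y" 2] by blast
  have "exp s \<le> exp (b * \<bar>y\<bar>)"
  proof -
    have "s \<le> t * \<bar>y\<bar>" using s(1) assms by (simp add: abs_mult)
    also have "\<dots> \<le> b * \<bar>y\<bar>" using b by (intro mult_right_mono) auto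
    finally show ?thesis by simp
  qed
  moreover have "(b * y)\<^sup>2 / 2 \<le> exp (b * \<bar>y\<bar>)"
  proof -
    have "1 + b * \<bar>y\<bar> + (b * \<bar>y\<bar>)\<^sup>2 / 2 \<le> exp (b * \<bar>y\<bar>)"
      using b by (intro exp_lower_Taylor_quadratic) auto
    moreover have "(b * \<bar>y\<bar>)\<^sup>2 = (b * y)\<^sup>2" "b * \<bar>y\<bar> \<ge> 0" using b by (auto simp: power_mult_distrib)
    ultimately show ?thesis by linarith
  qed
  ultimately have "exp s * ((b * y)\<^sup>2 / 2) \<le> exp (b * \<bar>y\<bar>) * exp (b * \<bar>y\<bar>)"
    by (intro mult_mono) auto
  also have "\<dots> = exp (a * \<bar>y\<bar>)" by (simp add: b_def flip: exp_add)
  finally have "(t / b)\<^sup>2 * (exp s * ((b * y)\<^sup>2 / 2)) \<le> (t / b)\<^sup>2 * exp (a * \<bar>y\<bar>)"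
    by (intro mult_left_mono) auto
  moreover have "(t / b)\<^sup>2 * (exp s * ((b * y)\<^sup>2 / 2)) = exp s / fact 2 * (- t * y)\<^sup>2"
    using b by (simp add: power2_eq_square field_simps)
  moreover have "t / b = 2 * t / a" by (simp add: b_def)
  ultimately show ?thesis using s(2) by (simp add: numeral_2_eq_2)
qed

text \<open>The preceding pointwise bound, integrated. The error is quadratic in t with a constant
  depending only on a and K, so for small t the linear term wins uniformly over all Y that share
  these constants and a positive lower bound on the mean.\<close>

lemma (in prob_space) exponential_moment_le:
  fixes Y :: "'a \<Rightarrow> real"
  assumes [measurable]: "random_variable borel Y"
    and G: "integrable M (\<lambda>x. exp (a * \<bar>Y x\<bar>))" and K: "expectation (\<lambda>x. exp (a * \<bar>Y x\<bar>)) \<le> K"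
    and t: "0 < t" "2 * t \<le> a"
  shows "integrable M (\<lambda>x. exp (- t * Y x))"
    and "expectation (\<lambda>x. exp (- t * Y x)) \<le> 1 - t * expectation Y + (2 * t / a)\<^sup>2 * K"
proof -
  have a: "a > 0" using t by linarith
  show i1: "integrable M (\<lambda>x. exp (- t * Y x))"
  proof (rule Bochner_Integration.integrable_bound[OF G])
    have "- (t * y) \<le> a * \<bar>y\<bar>" for y
    proof -
      have "- (t * y) \<le> t * \<bar>y\<bar>" using t by (metis abs_ge_minus_self abs_mult abs_of_pos)
      also have "\<dots> \<le> a * \<bar>y\<bar>" using t by (intro mult_right_mono) auto
      finally show ?thesis .
    qed
    then show "AE x in M. norm (exp (- t * Y x)) \<le> norm (exp (a * \<bar>Y x\<bar>))" by simp
  qed simp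
  have i2: "integrable M Y"
  proof (rule Bochner_Integration.integrable_bound[of _ "\<lambda>x. exp (a * \<bar>Y x\<bar>) / a"])
    have "\<bar>y\<bar> \<le> exp (a * \<bar>y\<bar>) / a" for y
    proof -
      have "a * \<bar>y\<bar> \<le> exp (a * \<bar>y\<bar>)" using exp_ge_add_one_self[of "a * \<bar>y\<bar>"] by linarith
      then show ?thesis using a by (simp add: field_simps)
    qed
    then show "AE x in M. norm (Y x) \<le> norm (exp (a * \<bar>Y x\<bar>) / a)" using a by simp
  qed (use G in auto)
  have "expectation (\<lambda>x. exp (- t * Y x))
      \<le> expectation (\<lambda>x. 1 - t * Y x + (2 * t / a)\<^sup>2 * exp (a * \<bar>Y x\<bar>))"
    using i1 i2 G exp_minus_le_quadratic[OF t] by (intro integral_mono) auto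
  also have "\<dots> = 1 - t * expectation Y + (2 * t / a)\<^sup>2 * expectation (\<lambda>x. exp (a * \<bar>Y x\<bar>))"
    using i2 G by (simp add: prob_space)
  also have "\<dots> \<le> 1 - t * expectation Y + (2 * t / a)\<^sup>2 * K"
    using K by (intro add_left_mono mult_left_mono) auto
  finally show "expectation (\<lambda>x. exp (- t * Y x)) \<le> 1 - t * expectation Y + (2 * t / a)\<^sup>2 * K" .
qed

text \<open>Markov's inequality for the product of the \<open>exp (- t * Y i x)\<close>, whose
  expectation factors by independence.\<close>

lemma (in prob_space) Chernoff_lower_tail:
  fixes Y :: "'b \<Rightarrow> 'a \<Rightarrow> real"
  assumes I: "finite I" and ind: "indep_vars (\<lambda>_. borel) Y I"
    and int: "\<And>i. i \<in> I \<Longrightarrow> integrable M (\<lambda>x. exp (- t * Y i x))"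
    and q: "\<And>i. i \<in> I \<Longrightarrow> expectation (\<lambda>x. exp (- t * Y i x)) \<le> q"
    and t: "0 < t"
  shows "prob {x \<in> space M. (\<Sum>i\<in>I. Y i x) \<le> b} \<le> exp (t * b) * q ^ card I"
proof -
  have ind': "indep_vars (\<lambda>_. borel) (\<lambda>i x. exp (- t * Y i x)) I"
    by (rule indep_vars_compose2[OF ind]) measurable
  have eq: "(\<Prod>i\<in>I. exp (- t * Y i x)) = exp (- t * (\<Sum>i\<in>I. Y i x))" for x
    using I by (simp add: exp_sum sum_distrib_left)
  have "prob {x \<in> space M. (\<Sum>i\<in>I. Y i x) \<le> b}
      = prob {x \<in> space M. (\<Prod>i\<in>I. exp (- t * Y i x)) \<ge> exp (- t * b)}"
    unfolding eq using t by simp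
  also have "\<dots> \<le> expectation (\<lambda>x. \<Prod>i\<in>I. exp (- t * Y i x)) / exp (- t * b)"
    by (intro integral_Markov_inequality_measure[where A = "{}"] indep_vars_integrable I ind' int)
       (auto intro!: prod_nonneg)
  also have "\<dots> = (\<Prod>i\<in>I. expectation (\<lambda>x. exp (- t * Y i x))) * exp (t * b)"
    by (subst indep_vars_lebesgue_integral[OF I ind' int]) (auto simp: exp_minus field_simps)
  also have "\<dots> \<le> (\<Prod>i\<in>I. q) * exp (t * b)"
    using q by (intro mult_right_mono prod_mono) (auto intro!: integral_nonneg_AE)
  finally show ?thesis by (simp add: mult.commute)
qed

section \<open>Nets of quadratic size in bounded plane sets\<close>

text \<open>A grid of squares of side r/2, with one point of L chosen from every square that meets
  L: points in a common square differ by at most r/2 in each coordinate. The net is taken inside L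
  because the tail estimate is available only at points of L.\<close>

lemma bounded_complex_net:
  fixes L :: "complex set"
  assumes "bounded L"
  obtains B where "B > 0" "\<And>r. 0 < r \<Longrightarrow> r \<le> 1 \<Longrightarrow>
    \<exists>A\<subseteq>L. finite A \<and> (\<forall>z\<in>L. \<exists>a\<in>A. dist z a \<le> r) \<and> real (card A) \<le> B / r\<^sup>2"
proof -
  obtain R where R: "R > 0" "\<And>z. z \<in> L \<Longrightarrow> cmod z \<le> R"
    using assms by (auto simp: bounded_pos)
  have "\<exists>A\<subseteq>L. finite A \<and> (\<forall>z\<in>L. \<exists>a\<in>A. dist z a \<le> r) \<and> real (card A) \<le> (4 * R + 5)\<^sup>2 / r\<^sup>2"
    if r: "0 < r" "r \<le> 1" for r
  proof -
    define f where "f z = (\<lfloor>Re z * 2 / r\<rfloor>, \<lfloor>Im z * 2 / r\<rfloor>)" for z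
    define N where "N = \<lceil>2 * R / r\<rceil>"
    have fl: "\<lfloor>x * 2 / r\<rfloor> \<in> {-N..N}" if "\<bar>x\<bar> \<le> R" for x
    proof -
      have "\<bar>x * 2 / r\<bar> \<le> 2 * R / r" using that r by (simp add: field_simps)
      then have "- (2 * R / r) \<le> x * 2 / r" "x * 2 / r \<le> 2 * R / r" by linarith+
      then show ?thesis unfolding N_def atLeastAtMost_iff by linarith
    qed
    have fL: "f ` L \<subseteq> {-N..N} \<times> {-N..N}"
      unfolding f_def
      by (intro image_subsetI SigmaI fl order_trans[OF abs_Re_le_cmod R(2)]
          order_trans[OF abs_Im_le_cmod R(2)])
    then have fin: "finite (f ` L)" by (rule finite_subset) auto
    define A where "A = inv_into L f ` f ` L"
    have "A \<subseteq> L" unfolding A_def by (auto intro: inv_into_into)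
    moreover have "finite A" using fin by (simp add: A_def)
    moreover have "\<exists>a\<in>A. dist z a \<le> r" if z: "z \<in> L" for z
    proof
      define a where "a = inv_into L f (f z)"
      show "a \<in> A" using z by (auto simp: A_def a_def)
      have "f a = f z" unfolding a_def using z by (simp add: f_inv_into_f)
      then have fa: "\<lfloor>Re a * 2 / r\<rfloor> = \<lfloor>Re z * 2 / r\<rfloor>" "\<lfloor>Im a * 2 / r\<rfloor> = \<lfloor>Im z * 2 / r\<rfloor>"
        by (auto simp: f_def)
      have close: "\<bar>x - y\<bar> \<le> r / 2" if "\<lfloor>x * 2 / r\<rfloor> = \<lfloor>y * 2 / r\<rfloor>" for x y :: real
      proof -
        have "\<bar>x * 2 / r - y * 2 / r\<bar> \<le> 1" using that by linarith
        then have "\<bar>x * 2 - y * 2\<bar> \<le> r" using r by (simp add: abs_divide flip: diff_divide_distrib)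
        then show ?thesis by linarith
      qed
      have "dist z a \<le> \<bar>Re (z - a)\<bar> + \<bar>Im (z - a)\<bar>" unfolding dist_norm by (rule cmod_le)
      also have "\<dots> \<le> r" using close[OF fa(1)] close[OF fa(2)] by (simp add: abs_minus_commute)
      finally show "dist z a \<le> r" .
    qed
    moreover have "real (card A) \<le> (4 * R + 5)\<^sup>2 / r\<^sup>2"
    proof -
      have "card A \<le> card (f ` L)" unfolding A_def using fin by (rule card_image_le)
      also have "\<dots> \<le> card ({-N..N} \<times> {-N..N})" using fL by (intro card_mono) auto
      finally have "real (card A) \<le> (real (card {-N..N}))\<^sup>2"
        by (simp add: card_cartesian_product power2_eq_square flip: of_nat_mult)
      also have "\<dots> \<le> ((4 * R + 5) / r)\<^sup>2"
      proof (rule power_mono)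
        have "0 \<le> 2 * R / r" using R(1) r by simp
        then have "N \<ge> 0" "real_of_int N \<le> 2 * R / r + 1"
          unfolding N_def by linarith+
        then have "real (card {-N..N}) \<le> 4 * R / r + 3" by simp
        \<comment> \<open>Here r \<le> 1 turns the additive 3 into a multiple of 1/r, which keeps
          the constant B independent of r.\<close>
        also have "\<dots> \<le> (4 * R + 5) / r" using r by (simp add: field_simps)
        finally show "real (card {-N..N}) \<le> (4 * R + 5) / r" .
      qed simp
      finally show ?thesis by (simp add: power_divide)
    qed
    ultimately show ?thesis by blast
  qed
  then show thesis using R(1) by (intro that[of "(4 * R + 5)\<^sup>2"]) auto
qed

section \<open>Measurability of existence over a compact set\<close>

text \<open>The uncountable union over L reduces to a countable dense subset D. Continuity moves a
  point of L into D at an arbitrarily small increase of h. Conversely, h attains its minimum on L,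
  and values below c + 1/(i+1) for every i force that minimum to be at most c.\<close>

lemma sets_exists_compact_le:
  fixes h :: "'b::{metric_space, second_countable_topology} \<Rightarrow> 'a \<Rightarrow> real"
  assumes L: "compact L"
    and cont: "\<And>\<omega>. \<omega> \<in> space M \<Longrightarrow> continuous_on L (\<lambda>z. h z \<omega>)"
    and [measurable]: "\<And>z. z \<in> L \<Longrightarrow> h z \<in> borel_measurable M"
  shows "{\<omega> \<in> space M. \<exists>z\<in>L. h z \<omega> \<le> c} \<in> sets M"
proof -
  obtain D where D: "countable D" "D \<subseteq> L" "L \<subseteq> closure D"
    using separable by metis
  have "(\<exists>z\<in>L. h z \<omega> \<le> c) \<longleftrightarrow> (\<forall>i::nat. \<exists>z\<in>D. h z \<omega> < c + 1 / real (Suc i))"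
    if \<omega>: "\<omega> \<in> space M" for \<omega>
  proof (intro iffI allI)
    fix i assume "\<exists>z\<in>L. h z \<omega> \<le> c"
    then obtain z where z: "z \<in> L" "h z \<omega> \<le> c" by blast
    define e where "e = c + 1 / real (Suc i) - h z \<omega>"
    have "e \<ge> 1 / real (Suc i)" using z(2) unfolding e_def by linarith
    then have "e > 0" by (rule less_le_trans[rotated]) simp
    then obtain d where d: "d > 0" "\<And>y. y \<in> L \<Longrightarrow> dist y z < d \<Longrightarrow> dist (h y \<omega>) (h z \<omega>) < e"
      using cont[OF \<omega>] z(1) unfolding continuous_on_iff by blast
    obtain y where "y \<in> D" "dist y z < d"
      using D(3) z(1) d(1) by (meson closure_approachable subsetD)
    then have "h y \<omega> < c + 1 / real (Suc i)"
      using d(2)[of y] D(2) by (auto simp: dist_real_def e_def)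
    then show "\<exists>z\<in>D. h z \<omega> < c + 1 / real (Suc i)" using \<open>y \<in> D\<close> by blast
  next
    assume *: "\<forall>i::nat. \<exists>z\<in>D. h z \<omega> < c + 1 / real (Suc i)"
    then have "L \<noteq> {}" using D(2) by blast
    then obtain z where z: "z \<in> L" "\<And>y. y \<in> L \<Longrightarrow> h z \<omega> \<le> h y \<omega>"
      using continuous_attains_inf[OF L _ cont[OF \<omega>]] by blast
    have "h z \<omega> \<le> c + e" if "e > 0" for e
    proof -
      obtain i where "1 / real (Suc i) < e" using \<open>e > 0\<close> nat_approx_posE by metis
      moreover obtain y where "y \<in> D" "h y \<omega> < c + 1 / real (Suc i)" using * by blast
      ultimately show ?thesis using z(2)[of y] D(2) by fastforce
    qed
    then show "\<exists>z\<in>L. h z \<omega> \<le> c" using z(1) field_le_epsilon by blast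
  qed
  then have "{\<omega> \<in> space M. \<exists>z\<in>L. h z \<omega> \<le> c}
      = {\<omega> \<in> space M. \<forall>i::nat. \<exists>z\<in>D. h z \<omega> < c + 1 / real (Suc i)}" by blast
  also have "\<dots> \<in> sets M"
  proof (intro sets.sets_Collect_countable_All)
    fix i
    have "(\<Union>z\<in>D. {\<omega> \<in> space M. h z \<omega> < c + 1 / real (Suc i)}) \<in> sets M"
    proof (intro sets.countable_UN'' D(1))
      fix z assume "z \<in> D"
      then have [measurable]: "h z \<in> borel_measurable M" using D(2) assms(3) by blast
      show "{\<omega> \<in> space M. h z \<omega> < c + 1 / real (Suc i)} \<in> sets M" by measurable
    qed
    also have "(\<Union>z\<in>D. {\<omega> \<in> space M. h z \<omega> < c + 1 / real (Suc i)})
        = {\<omega> \<in> space M. \<exists>z\<in>D. h z \<omega> < c + 1 / real (Suc i)}" by blast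
    finally show "{\<omega> \<in> space M. \<exists>z\<in>D. h z \<omega> < c + 1 / real (Suc i)} \<in> sets M" .
  qed
  finally show ?thesis .
qed

section \<open>Exponential moments of the logarithm and a uniform tail bound\<close>

text \<open>For 0 < u \<le> R, exp(a |ln u|) is the larger of u^a and u^(-a). The first is at most
  R^a, and the second is integrable by the dyadic estimate. The bound K does not involve z.\<close>

lemma exponential_moment_ln_cmod:
  fixes \<mu> :: "complex measure"
  assumes \<mu>: "prob_space \<mu>" and [measurable_cong]: "sets \<mu> = sets borel"
    and ball: "\<And>r. r > 0 \<Longrightarrow> measure \<mu> (ball z r) \<le> C * r powr \<epsilon>"
    and a: "0 < a" "a < \<epsilon>"
    and R: "R \<ge> 1" "AE w in \<mu>. cmod (z - w) \<le> R"
  defines "K \<equiv> R powr a + 1 + 2 powr a * C / (1 - 2 powr (a - \<epsilon>))"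
  shows "integrable \<mu> (\<lambda>w. exp (a * \<bar>ln (cmod (z - w))\<bar>))"
    and "(\<integral>w. exp (a * \<bar>ln (cmod (z - w))\<bar>) \<partial>\<mu>) \<le> K"
proof -
  interpret prob_space \<mu> by fact
  have "(2::real) powr (a - \<epsilon>) < 1" using a by (simp add: powr_less_one)
  moreover have "C \<ge> 0" using order_trans[OF measure_nonneg ball[of 1]] by simp
  ultimately have J: "0 \<le> 1 + 2 powr a * C / (1 - 2 powr (a - \<epsilon>))" by simp
  have pw: "exp (a * \<bar>ln u\<bar>) \<le> R powr a + u powr - a" if "0 \<le> u" "u \<le> R" for u
  proof (cases "u = 0 \<or> u \<ge> 1")
    \<comment> \<open>The point u = 0 belongs here: \<open>ln 0 = 0\<close> gives the value 1, which
      is at most \<open>R powr a\<close> since R \<ge> 1.\<close>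
    case True
    then have "exp (a * \<bar>ln u\<bar>) \<le> R powr a"
      using that R a by (auto simp: ge_one_powr_ge_zero powr_def intro!: mult_left_mono)
    then show ?thesis by (rule order_trans) simp
  next
    case False
    then have "exp (a * \<bar>ln u\<bar>) = u powr - a" using that by (simp add: powr_def abs_if)
    then show ?thesis by simp
  qed
  have le: "(\<integral>\<^sup>+w. ennreal (exp (a * \<bar>ln (cmod (z - w))\<bar>)) \<partial>\<mu>) \<le> ennreal K"
  proof -
    have "(\<integral>\<^sup>+w. ennreal (exp (a * \<bar>ln (cmod (z - w))\<bar>)) \<partial>\<mu>)
        \<le> (\<integral>\<^sup>+w. ennreal (R powr a) + ennreal (dist z w powr - a) \<partial>\<mu>)"
      using R(2) by (intro nn_integral_mono_AE)
        (auto elim!: eventually_mono simp: dist_norm pw simp flip: ennreal_plus intro!: ennreal_leI)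
    also have "\<dots> = ennreal (R powr a) + (\<integral>\<^sup>+w. ennreal (dist z w powr - a) \<partial>\<mu>)"
      by (simp add: nn_integral_add emeasure_space_1)
    also have "\<dots> \<le> ennreal (R powr a) + ennreal (1 + 2 powr a * C / (1 - 2 powr (a - \<epsilon>)))"
      using nn_integral_dist_powr_le[OF \<mu> assms(2) ball a] by (intro add_left_mono)
    also have "\<dots> = ennreal K"
      using J by (simp add: K_def add.assoc flip: ennreal_plus)
    finally show ?thesis .
  qed
  show int: "integrable \<mu> (\<lambda>w. exp (a * \<bar>ln (cmod (z - w))\<bar>))"
    using le by (intro integrableI_bounded) (auto intro: le_less_trans)
  have "ennreal (\<integral>w. exp (a * \<bar>ln (cmod (z - w))\<bar>) \<partial>\<mu>) \<le> ennreal K"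
    using le by (subst nn_integral_eq_integral[OF int, symmetric]) auto
  moreover have "K \<ge> 0" using J by (simp add: K_def add.assoc)
  ultimately show "(\<integral>w. exp (a * \<bar>ln (cmod (z - w))\<bar>) \<partial>\<mu>) \<le> K"
    by (simp add: ennreal_le_iff)
qed

text \<open>Lets the lower bound on the potential be read as a lower bound on the mean of ln|z - w|
  under \<mu>.\<close>

lemma log_potential_eq_integral:
  assumes [measurable_cong]: "sets \<mu> = sets borel" and "closed (msupport \<mu>)"
  shows "log_potential \<mu> z = (\<integral>w. ln (cmod (z - w)) \<partial>\<mu>)"
proof -
  have [measurable]: "msupport \<mu> \<in> sets borel" using assms(2) by simp
  have "AE w in \<mu>. indicator (msupport \<mu>) w *\<^sub>R ln (cmod (z - w)) = ln (cmod (z - w))"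
    using AE_msupport[OF assms(1)] by eventually_elim simp
  then show ?thesis
    unfolding log_potential_def set_lebesgue_integral_def by (intro integral_cong_AE) measurable
qed

text \<open>The constants R, a, K and t are all fixed before z and n, so a single rate \<gamma>
  serves every point of L. This uniformity is what the later union bound needs.\<close>

lemma uniform_lower_tail:
  fixes \<mu> :: "complex measure" and L :: "complex set" and M :: "'a measure"
    and X :: "nat \<Rightarrow> 'a \<Rightarrow> complex"
  assumes \<mu>: "prob_space \<mu>" and \<mu>b: "sets \<mu> = sets borel"
    and supp: "compact (msupport \<mu>)"
    and "\<epsilon> > 0" and ball: "\<And>z r. r > 0 \<Longrightarrow> measure \<mu> (ball z r) \<le> C * r powr \<epsilon>"
    and m: "m > 0" and L: "bounded L" "L \<subseteq> {z. log_potential \<mu> z \<ge> m}"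
    and M: "prob_space M"
    and ind: "prob_space.indep_vars M (\<lambda>_. borel) X {1..}"
    and distr: "\<And>k. k \<ge> 1 \<Longrightarrow> distr M borel (X k) = \<mu>"
  obtains \<gamma> where "\<gamma> > 0"
    "\<And>z n. z \<in> L \<Longrightarrow> measure M {\<omega> \<in> space M. (\<Sum>k=1..n. ln (cmod (z - X k \<omega>))) \<le> real n * m / 2}
       \<le> exp (- \<gamma> * real n)"
proof -
  interpret M: prob_space M by fact
  interpret \<mu>: prob_space \<mu> by fact
  note [measurable_cong] = \<mu>b
  obtain R1 where R1: "\<And>w. w \<in> msupport \<mu> \<Longrightarrow> cmod w \<le> R1"
    using compact_imp_bounded[OF supp] by (auto simp: bounded_iff)
  obtain R2 where R2: "\<And>z. z \<in> L \<Longrightarrow> cmod z \<le> R2"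
    using L(1) by (auto simp: bounded_iff)
  define R where "R = max 1 (R1 + R2)"
  have R: "R \<ge> 1" by (simp add: R_def)
  have AE_R: "AE w in \<mu>. cmod (z - w) \<le> R" if "z \<in> L" for z
    using AE_msupport[OF \<mu>b]
  proof eventually_elim
    case (elim w)
    then show ?case
      using R1[of w] R2[OF that] norm_triangle_ineq4[of z w] by (simp add: R_def)
  qed
  define a where "a = \<epsilon> / 2"
  have a: "0 < a" "a < \<epsilon>" using \<open>\<epsilon> > 0\<close> by (auto simp: a_def)
  define K where "K = R powr a + 1 + 2 powr a * C / (1 - 2 powr (a - \<epsilon>))"
  have "(2::real) powr (a - \<epsilon>) < 1" using a by (simp add: powr_less_one)
  moreover have "C \<ge> 0" using order_trans[OF measure_nonneg ball[of 1]] by simp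
  ultimately have "2 powr a * C / (1 - 2 powr (a - \<epsilon>)) \<ge> 0" by simp
  then have K: "K > 0" unfolding K_def using powr_ge_zero[of R a] by linarith
  \<comment> \<open>The bound a/2 is required by the moment estimate; the other makes the quadratic
    error (2t/a)^2 K at most tm/4.\<close>
  define t where "t = min (a / 2) (m * a\<^sup>2 / (16 * K))"
  have t: "0 < t" "2 * t \<le> a" using a m K by (auto simp: t_def)
  have quad: "(2 * t / a)\<^sup>2 * K \<le> t * m / 4"
  proof -
    have "t * (16 * K) \<le> m * a\<^sup>2" using K by (simp add: t_def min_def field_simps)
    then have "t * (t * (16 * K)) \<le> t * (m * a\<^sup>2)" using t by (intro mult_left_mono) auto
    then show ?thesis using a by (simp add: power2_eq_square field_simps)
  qed
  have rv: "X k \<in> borel_measurable M" if "k \<ge> 1" for k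
    using ind that unfolding M.indep_vars_def2 by auto
  show thesis
  \<comment> \<open>Per root, the moment generating function gains 3tm/4 in the exponent, and the
    threshold nm/2 costs tm/2; the difference tm/4 is the rate.\<close>
  proof (rule that[of "t * m / 4"])
    show "t * m / 4 > 0" using t m by simp
    fix z n assume z: "z \<in> L"
    let ?Y = "\<lambda>w. ln (cmod (z - w))"
    note G = exponential_moment_ln_cmod[OF \<mu> \<mu>b ball a R AE_R[OF z], folded K_def]
    have int: "integrable \<mu> (\<lambda>w. exp (- t * ?Y w))"
      by (rule \<mu>.exponential_moment_le(1)[OF _ G t]) measurable
    have "\<mu>.expectation (\<lambda>w. exp (- t * ?Y w)) \<le> 1 - t * \<mu>.expectation ?Y + (2 * t / a)\<^sup>2 * K"
      by (rule \<mu>.exponential_moment_le(2)[OF _ G t]) measurable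
    also have "\<mu>.expectation ?Y = log_potential \<mu> z"
      using log_potential_eq_integral[OF \<mu>b] supp by (simp add: compact_imp_closed)
    also have "1 - t * log_potential \<mu> z + (2 * t / a)\<^sup>2 * K \<le> 1 - t * m + t * m / 4"
      using L(2) z t quad by (intro add_mono diff_left_mono mult_left_mono) auto
    also have "\<dots> \<le> exp (- (3 * t * m / 4))"
      using exp_ge_add_one_self[of "- (3 * t * m / 4)"] by (simp add: mult.commute)
    finally have mgf: "\<mu>.expectation (\<lambda>w. exp (- t * ?Y w)) \<le> exp (- (3 * t * m / 4))" .
    have tr: "integrable M (\<lambda>\<omega>. exp (- t * ?Y (X k \<omega>)))"
      "M.expectation (\<lambda>\<omega>. exp (- t * ?Y (X k \<omega>))) = \<mu>.expectation (\<lambda>w. exp (- t * ?Y w))"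
      if k: "k \<ge> 1" for k
    proof -
      note [measurable] = rv[OF k]
      show "integrable M (\<lambda>\<omega>. exp (- t * ?Y (X k \<omega>)))"
        using int by (subst (asm) distr[OF k, symmetric], subst (asm) integrable_distr_eq) auto
      show "M.expectation (\<lambda>\<omega>. exp (- t * ?Y (X k \<omega>))) = \<mu>.expectation (\<lambda>w. exp (- t * ?Y w))"
        by (subst distr[OF k, symmetric], subst integral_distr) auto
    qed
    have ind': "M.indep_vars (\<lambda>_. borel) (\<lambda>k \<omega>. ?Y (X k \<omega>)) {1..n}"
      by (rule M.indep_vars_compose2[OF M.indep_vars_subset[OF ind]]) auto
    have "M.prob {\<omega> \<in> space M. (\<Sum>k=1..n. ?Y (X k \<omega>)) \<le> real n * m / 2}
        \<le> exp (t * (real n * m / 2)) * exp (- (3 * t * m / 4)) ^ card {1..n}"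
    proof (intro M.Chernoff_lower_tail ind' t(1))
      fix k assume "k \<in> {1..n}"
      then have k: "k \<ge> 1" by simp
      show "integrable M (\<lambda>\<omega>. exp (- t * ?Y (X k \<omega>)))" by (rule tr(1)[OF k])
      show "M.expectation (\<lambda>\<omega>. exp (- t * ?Y (X k \<omega>))) \<le> exp (- (3 * t * m / 4))"
        unfolding tr(2)[OF k] by (rule mgf)
    qed simp
    also have "\<dots> = exp (t * (real n * m / 2) + real n * (- (3 * t * m / 4)))"
      by (simp only: card_atLeastAtMost One_nat_def diff_Suc_Suc minus_nat.diff_0 exp_add exp_of_nat_mult)
    also have "t * (real n * m / 2) + real n * (- (3 * t * m / 4)) = - (t * m / 4) * real n"
      by (simp add: field_simps)
    finally show "M.prob {\<omega> \<in> space M. (\<Sum>k=1..n. ?Y (X k \<omega>)) \<le> real n * m / 2}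
        \<le> exp (- (t * m / 4) * real n)" .
  qed
qed

section \<open>Points of the lemniscate far from all roots\<close>

text \<open>Since z is at least \<rho> from each root, a shift by s\<rho> enlarges each factor by a
  ratio of at most 1 + s, and ln(1 + s) \<le> s.\<close>

lemma sum_ln_cmod_perturb:
  fixes x :: "nat \<Rightarrow> complex"
  assumes \<rho>: "0 < \<rho>" and s: "0 < s" "s < 1" and zz: "cmod (z - z') \<le> s * \<rho>"
    and far: "\<And>k. k \<in> {1..n} \<Longrightarrow> \<rho> \<le> cmod (z - x k)"
    and z: "z \<in> lemniscate x n"
  shows "(\<Sum>k=1..n. ln (cmod (z' - x k))) \<le> real n * s"
proof -
  have "ln (cmod (z' - x k)) \<le> ln (cmod (z - x k)) + s" if k: "k \<in> {1..n}" for k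
  proof -
    have pos: "0 < cmod (z - x k)" using far[OF k] \<rho> by linarith
    have sr: "s * \<rho> \<le> s * cmod (z - x k)" using far[OF k] s by simp
    \<comment> \<open>As s < 1, the shifted point cannot hit a root. This matters because with
      \<open>ln 0 = 0\<close> the logarithm is not monotone at 0.\<close>
    have "s * cmod (z - x k) < cmod (z - x k)" using s pos by simp
    moreover have "cmod (z - x k) \<le> cmod (z - z') + cmod (z' - x k)"
      using norm_triangle_ineq[of "z - z'" "z' - x k"] by simp
    ultimately have pos': "0 < cmod (z' - x k)" using zz sr by linarith
    have "cmod (z' - x k) \<le> cmod (z - z') + cmod (z - x k)"
      using norm_triangle_ineq[of "z' - z" "z - x k"] by (simp add: norm_minus_commute)
    then have "cmod (z' - x k) \<le> cmod (z - x k) * (1 + s)" using zz sr by (simp add: algebra_simps)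
    then have "ln (cmod (z' - x k)) \<le> ln (cmod (z - x k) * (1 + s))"
      using pos' by (intro ln_mono) auto
    also have "\<dots> = ln (cmod (z - x k)) + ln (1 + s)" using pos s by (simp add: ln_mult)
    also have "\<dots> \<le> ln (cmod (z - x k)) + s" using s by (simp add: ln_add_one_self_le_self)
    finally show ?thesis .
  qed
  then have "(\<Sum>k=1..n. ln (cmod (z' - x k))) \<le> (\<Sum>k=1..n. ln (cmod (z - x k)) + s)"
    by (intro sum_mono)
  also have "\<dots> = ln (\<Prod>k=1..n. cmod (z - x k)) + real n * s"
  proof -
    have "\<And>k. k \<in> {1..n} \<Longrightarrow> 0 < cmod (z - x k)" using far \<rho> by (metis less_le_trans)
    then show ?thesis by (subst ln_prod) (auto simp: sum.distrib)
  qed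
  also have "(\<Prod>k=1..n. cmod (z - x k)) = cmod (root_poly x n z)"
    by (simp add: root_poly_def prod_norm)
  \<comment> \<open>The case of a vanishing polynomial is settled by
    \<open>ln 0 = 0\<close>.\<close>
  also have "ln \<dots> \<le> 0"
    using z by (cases "root_poly x n z = 0") (auto simp: lemniscate_def)
  finally show ?thesis by simp
qed

text \<open>Supplies the measurability that \<open>overwhelming_prob\<close> demands: the set is the
  exceptional event, whose definition quantifies over uncountably many z.\<close>

lemma sets_exists_lemniscate_far:
  fixes X :: "nat \<Rightarrow> 'a \<Rightarrow> complex"
  assumes L: "compact L" and rv: "\<And>k. k \<in> {1..n} \<Longrightarrow> X k \<in> borel_measurable M"
  shows "{\<omega> \<in> space M. \<exists>z\<in>L. z \<in> lemniscate (\<lambda>k. X k \<omega>) n \<and> (\<forall>k\<in>{1..n}. \<rho> \<le> cmod (z - X k \<omega>))}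
    \<in> sets M"
proof -
  \<comment> \<open>The conditions on \<open>z\<close> hold iff \<open>h j z \<omega> \<le> 0\<close> for some \<open>j\<close>; the strict inequality
    \<open>|p\<^sub>n(z)| < 1\<close> is exhausted by closed conditions to stay within the compactness argument.\<close>
  define h where "h j z \<omega> = max 0 (cmod (\<Prod>k=1..n. z - X k \<omega>) - (1 - 1 / real (Suc j)))
      + (\<Sum>k=1..n. max 0 (\<rho> - cmod (z - X k \<omega>)))" for j z \<omega>
  \<comment> \<open>Positive parts merge the conjunction into one continuous inequality: a sum of
    nonnegative terms is at most 0 only if every term vanishes.\<close>
  have h: "h j z \<omega> \<le> 0 \<longleftrightarrow> cmod (\<Prod>k=1..n. z - X k \<omega>) \<le> 1 - 1 / real (Suc j)
      \<and> (\<forall>k\<in>{1..n}. \<rho> \<le> cmod (z - X k \<omega>))" for j z \<omega>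
  proof -
    have "(\<Sum>k=1..n. max 0 (\<rho> - cmod (z - X k \<omega>))) \<ge> 0" by (intro sum_nonneg) auto
    then have "h j z \<omega> \<le> 0 \<longleftrightarrow> max 0 (cmod (\<Prod>k=1..n. z - X k \<omega>) - (1 - 1 / real (Suc j))) = 0
        \<and> (\<Sum>k=1..n. max 0 (\<rho> - cmod (z - X k \<omega>))) = 0"
      unfolding h_def by linarith
    also have "(\<Sum>k=1..n. max 0 (\<rho> - cmod (z - X k \<omega>))) = 0 \<longleftrightarrow> (\<forall>k\<in>{1..n}. \<rho> \<le> cmod (z - X k \<omega>))"
      by (subst sum_nonneg_eq_0_iff) (auto simp: max_def split: if_splits)
    finally show ?thesis by (simp add: max_def algebra_simps split: if_splits)
  qed
  have less: "u < 1 \<longleftrightarrow> (\<exists>j. u \<le> 1 - 1 / real (Suc j))" for u :: real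
  proof
    assume "u < 1"
    then obtain j where "1 / real (Suc j) < 1 - u" using nat_approx_posE[of "1 - u"] by auto
    then show "\<exists>j. u \<le> 1 - 1 / real (Suc j)" by (intro exI[of _ j]) linarith
  next
    assume "\<exists>j. u \<le> 1 - 1 / real (Suc j)"
    then obtain j where "u \<le> 1 - 1 / real (Suc j)" by blast
    moreover have "0 < 1 / real (Suc j)" by simp
    ultimately show "u < 1" by linarith
  qed
  have "{\<omega> \<in> space M. \<exists>z\<in>L. z \<in> lemniscate (\<lambda>k. X k \<omega>) n \<and> (\<forall>k\<in>{1..n}. \<rho> \<le> cmod (z - X k \<omega>))}
      = (\<Union>j. {\<omega> \<in> space M. \<exists>z\<in>L. h j z \<omega> \<le> 0})"
    unfolding h lemniscate_def root_poly_def mem_Collect_eq less by blast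
  moreover have "{\<omega> \<in> space M. \<exists>z\<in>L. h j z \<omega> \<le> 0} \<in> sets M" for j
  proof (rule sets_exists_compact_le[OF L])
    show "continuous_on L (\<lambda>z. h j z \<omega>)" for \<omega>
      unfolding h_def by (intro continuous_intros)
    show "h j z \<in> borel_measurable M" for z
      unfolding h_def[abs_def] using rv
      by (intro borel_measurable_add borel_measurable_max borel_measurable_sum borel_measurable_diff
          borel_measurable_norm borel_measurable_prod borel_measurable_const) auto
  qed
  ultimately show ?thesis by auto
qed

section \<open>Union bound over the net\<close>

theorem theorem1p3:
  fixes \<mu> :: "complex measure" and C \<epsilon> m :: real and L :: "complex set"
    and M :: "'a measure" and X :: "nat \<Rightarrow> 'a \<Rightarrow> complex"
  assumes "prob_space \<mu>" and "sets \<mu> = sets borel"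
    and "compact (msupport \<mu>)"
    and "\<epsilon> > 0" and "\<And>z r. r > 0 \<Longrightarrow> measure \<mu> (ball z r) \<le> C * r powr \<epsilon>"
    and "m > 0" and "compact L" and "L \<subseteq> {z. log_potential \<mu> z \<ge> m}"
    and "prob_space M"
    and "prob_space.indep_vars M (\<lambda>_. borel) X {1..}"
    and "\<And>k. k \<ge> 1 \<Longrightarrow> distr M borel (X k) = \<mu>"
  shows "\<exists>c0>0. overwhelming_prob M (\<lambda>n. {\<omega> \<in> space M.
           lemniscate (\<lambda>k. X k \<omega>) n \<inter> L \<subseteq> (\<Union>k\<in>{1..n}. ball (X k \<omega>) (exp (- c0 * real n)))})"
proof -
  interpret prob_space M by fact
  have bL: "bounded L" using \<open>compact L\<close> by (rule compact_imp_bounded)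
  obtain \<gamma> where \<gamma>: "\<gamma> > 0"
    and tail: "\<And>z n. z \<in> L \<Longrightarrow>
      prob {\<omega> \<in> space M. (\<Sum>k=1..n. ln (cmod (z - X k \<omega>))) \<le> real n * m / 2} \<le> exp (- \<gamma> * real n)"
    using uniform_lower_tail[OF assms(1-6) bL assms(8-11)] by blast
  obtain B where B: "B > 0" and net: "\<And>r. 0 < r \<Longrightarrow> r \<le> 1 \<Longrightarrow>
      \<exists>A\<subseteq>L. finite A \<and> (\<forall>z\<in>L. \<exists>a\<in>A. dist z a \<le> r) \<and> real (card A) \<le> B / r\<^sup>2"
    using bounded_complex_net[OF bL] by blast
  have rv: "random_variable borel (X k)" if "k \<ge> 1" for k
    using assms(10) that unfolding indep_vars_def2 by auto
  \<comment> \<open>The bound m/2 brings the perturbation error ns below the tail threshold nm/2;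
    the bound 1/2 ensures s < 1.\<close>
  define s where "s = min (1 / 2) (m / 2)"
  have s: "0 < s" "s < 1" "s \<le> m / 2" using \<open>m > 0\<close> by (auto simp: s_def)
  \<comment> \<open>With radius e^(-\<gamma>n/4) the net has O(e^(\<gamma>n/2)) points, so half of
    the tail rate \<gamma> survives the union bound.\<close>
  define \<rho> where "\<rho> n = exp (- (\<gamma> / 4) * real n)" for n
  have \<rho>: "0 < \<rho> n" "\<rho> n \<le> 1" for n using \<gamma> by (auto simp: \<rho>_def)
  define Bad where "Bad n = {\<omega> \<in> space M. \<exists>z\<in>L. z \<in> lemniscate (\<lambda>k. X k \<omega>) n \<and>
      (\<forall>k\<in>{1..n}. \<rho> n \<le> cmod (z - X k \<omega>))}" for n
  have Bad[measurable]: "Bad n \<in> events" for n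
    unfolding Bad_def using rv by (intro sets_exists_lemniscate_far \<open>compact L\<close>) auto
  \<comment> \<open>Lying outside all the open balls means having distance at least
    \<open>\<rho> n\<close> from every root, so the two events are exact complements.\<close>
  have Good: "{\<omega> \<in> space M. lemniscate (\<lambda>k. X k \<omega>) n \<inter> L \<subseteq> (\<Union>k\<in>{1..n}. ball (X k \<omega>) (\<rho> n))}
      = space M - Bad n" for n
    unfolding Bad_def
    by (auto simp: subset_iff dist_norm norm_minus_commute not_le) (meson not_le)
  have prob_Bad: "prob (Bad n) \<le> B / s\<^sup>2 * exp (- (\<gamma> / 2) * real n)" for n
  proof -
    have "s * \<rho> n \<le> 1" using s \<rho>[of n] mult_le_one[of s "\<rho> n"] by simp
    then obtain A where A: "A \<subseteq> L" "finite A" "\<forall>z\<in>L. \<exists>a\<in>A. dist z a \<le> s * \<rho> n"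
        "real (card A) \<le> B / (s * \<rho> n)\<^sup>2"
      using net[of "s * \<rho> n"] s \<rho>[of n] by auto
    define T where "T a = {\<omega> \<in> space M. (\<Sum>k=1..n. ln (cmod (a - X k \<omega>))) \<le> real n * m / 2}" for a
    have T: "T a \<in> events" for a
    proof -
      have "(\<lambda>\<omega>. \<Sum>k=1..n. ln (cmod (a - X k \<omega>))) \<in> borel_measurable M"
      proof (rule borel_measurable_sum)
        fix k assume "k \<in> {1..n}"
        then have [measurable]: "random_variable borel (X k)" by (intro rv) simp
        show "(\<lambda>\<omega>. ln (cmod (a - X k \<omega>))) \<in> borel_measurable M" by measurable
      qed
      then show ?thesis unfolding T_def by measurable
    qed
    have "Bad n \<subseteq> (\<Union>a\<in>A. T a)"
    proof
      fix \<omega> assume "\<omega> \<in> Bad n"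
      then obtain z where z: "\<omega> \<in> space M" "z \<in> L" "z \<in> lemniscate (\<lambda>k. X k \<omega>) n"
          "\<And>k. k \<in> {1..n} \<Longrightarrow> \<rho> n \<le> cmod (z - X k \<omega>)"
        by (auto simp: Bad_def)
      obtain a where a: "a \<in> A" "cmod (z - a) \<le> s * \<rho> n" using A(3) z(2) by (auto simp: dist_norm)
      have "(\<Sum>k=1..n. ln (cmod (a - X k \<omega>))) \<le> real n * s"
        by (rule sum_ln_cmod_perturb[OF \<rho>(1) s(1,2) a(2) z(4) z(3)])
      also have "\<dots> \<le> real n * m / 2" using mult_left_mono[OF s(3), of "real n"] by simp
      finally show "\<omega> \<in> (\<Union>a\<in>A. T a)" using a(1) z(1) by (auto simp: T_def)
    qed
    then have "prob (Bad n) \<le> prob (\<Union>a\<in>A. T a)"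
      using T A(2) by (intro finite_measure_mono) auto
    also have "\<dots> \<le> (\<Sum>a\<in>A. prob (T a))"
      using T A(2) by (intro finite_measure_subadditive_finite) auto
    also have "\<dots> \<le> real (card A) * exp (- \<gamma> * real n)"
      unfolding T_def using tail A(1) by (intro sum_bounded_above) auto
    also have "\<dots> \<le> B / (s * \<rho> n)\<^sup>2 * exp (- \<gamma> * real n)"
      using A(4) by (intro mult_right_mono) auto
    also have "\<dots> = B / s\<^sup>2 * (exp (- \<gamma> * real n) / (\<rho> n)\<^sup>2)"
      by (simp add: power_mult_distrib)
    also have "exp (- \<gamma> * real n) / (\<rho> n)\<^sup>2 = exp (- (\<gamma> / 2) * real n)"
      by (simp add: \<rho>_def field_simps flip: exp_double exp_diff)
    finally show ?thesis .
  qed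
  \<comment> \<open>Half of the remaining rate \<gamma>/2 is given up to absorb the constant B/s^2,
    which is at most \<gamma>n/4, hence at most e^(\<gamma>n/4), once n is large.\<close>
  have "overwhelming_prob M (\<lambda>n. space M - Bad n)"
    unfolding overwhelming_prob_def
  proof (intro conjI allI exI[of _ "\<gamma> / 4"])
    show "\<gamma> / 4 > 0" using \<gamma> by simp
    show "\<forall>\<^sub>F n in sequentially. 1 - exp (- (\<gamma> / 4) * real n) \<le> prob (space M - Bad n)"
      using eventually_ge_at_top[of "nat \<lceil>B / s\<^sup>2 * 4 / \<gamma>\<rceil>"]
    proof eventually_elim
      case (elim n)
      then have "B / s\<^sup>2 * 4 / \<gamma> \<le> real n" by linarith
      then have "B / s\<^sup>2 * 4 \<le> real n * \<gamma>" using \<gamma> by (simp only: pos_divide_le_eq)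
      then have "B / s\<^sup>2 \<le> \<gamma> / 4 * real n" by (simp add: mult.commute)
      also have "\<dots> \<le> exp (\<gamma> / 4 * real n)"
        using exp_ge_add_one_self[of "\<gamma> / 4 * real n"] by linarith
      finally have "B / s\<^sup>2 * exp (- (\<gamma> / 2) * real n) \<le> exp (\<gamma> / 4 * real n) * exp (- (\<gamma> / 2) * real n)"
        by (intro mult_right_mono) auto
      also have "\<dots> = exp (- (\<gamma> / 4) * real n)" by (simp flip: exp_add)
      finally show ?case using prob_Bad[of n] by (simp add: prob_compl)
    qed
  qed auto
  then show ?thesis
    using \<gamma> unfolding Good[symmetric] \<rho>_def by (intro exI[of _ "\<gamma> / 4"]) auto
qed

end
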